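(* Let $G$ be a weighted graph and let $a,b$ be fraternal twins in $G$. Let $G'$ be the weighted graph obtained from $G-b$ by changing the weights of $a$ to \[ \alpha'(a)=\alpha(a)\beta(b)+\beta(a)\alpha(b),\qquad \beta'(a)=\beta(a)\beta(b)+\alpha(a)\alpha(b)(x-1)^{2}, \] all other vertices keeping their weights. Then $q(G)=q(G')$.
   Context: All graphs are finite and may have loops (at most one per vertex) but no multiple edges. The adjacency matrix of a graph is the symmetric $0/1$ matrix over $GF(2)$ whose diagonal entry at $v$ is $1$ iff $v$ is looped; $r(G)$ and $n(G)$ denote its rank and nullity over $GF(2)$ (the empty graph has $r=n=0$). For $S\subseteq V(G)$, $G[S]$ is the induced subgraph. Let $A$ be a commutative ring with unity containing elements $x,y$. A weighted graph is a graph $G$ together with functions $\alpha,\beta:V(G)\to A$, and its weighted interlace polynomial is \[ q(G)=\sum_{S\subseteq V(G)}\Big(\prod_{s\in S}\alpha(s)\Big)\Big(\prod_{v\notin S}\beta(v)\Big)(x-1)^{r(G[S])}(y-1)^{n(G[S])}. \] Two distinct vertices $a,b$ are fraternal twins if (i) either both are looped and they are not adjacent, or both are unlooped and they are adjacent, and (ii) they have the same neighbors outside $\{a,b\}$. *)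

theory Defs
  imports Complex_Main "HOL-Library.Z2" "HOL-Library.Function_Algebras"
begin

text \<open>An edge is the set of its endpoints, so the singleton \<open>{v}\<close> is a loop at \<open>v\<close>. Using a set of
  edges excludes multiple edges and multiple loops.\<close>

record 'v lgraph =
  verts :: "'v set"
  edges :: "'v set set"

definition lgraph :: "('v, 'm) lgraph_scheme \<Rightarrow> bool" where
  "lgraph G \<longleftrightarrow> finite (verts G) \<and> (\<forall>e\<in>edges G. \<exists>u\<in>verts G. \<exists>v\<in>verts G. e = {u, v})"

definition adjacent :: "('v, 'm) lgraph_scheme \<Rightarrow> 'v \<Rightarrow> 'v \<Rightarrow> bool" where
  "adjacent G u v \<longleftrightarrow> {u, v} \<in> edges G"

definition looped :: "('v, 'm) lgraph_scheme \<Rightarrow> 'v \<Rightarrow> bool" where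
  "looped G v \<longleftrightarrow> {v} \<in> edges G"

definition induced_subgraph :: "('v, 'm) lgraph_scheme \<Rightarrow> 'v set \<Rightarrow> ('v, 'm) lgraph_scheme" where
  "induced_subgraph G S = G\<lparr>verts := S, edges := {e \<in> edges G. e \<subseteq> S}\<rparr>"

definition delete_vertex :: "('v, 'm) lgraph_scheme \<Rightarrow> 'v \<Rightarrow> ('v, 'm) lgraph_scheme" where
  "delete_vertex G b = induced_subgraph G (verts G - {b})"

definition adjacency_matrix :: "('v, 'm) lgraph_scheme \<Rightarrow> 'v \<Rightarrow> 'v \<Rightarrow> bit" where
  "adjacency_matrix G u v =
     (if u = v then (if looped G v then 1 else 0) else (if adjacent G u v then 1 else 0))"

text \<open>The space of vectors over \<open>GF(2)\<close> with coordinates indexed by the type \<open>'v\<close>. The vectors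
  indexed by a vertex set are the ones that vanish outside it.\<close>

global_interpretation gf2: vector_space "\<lambda>(c::bit) (f::'v \<Rightarrow> bit) v. c * f v"
  by unfold_locales (auto simp: fun_eq_iff algebra_simps)

text \<open>The columns vanish outside \<open>verts G\<close> because the edges of a graph lie in its vertex set.\<close>

definition graph_rank :: "('v, 'm) lgraph_scheme \<Rightarrow> nat" where
  "graph_rank G = gf2.dim (gf2.span ((\<lambda>v u. adjacency_matrix G u v) ` verts G))"

definition graph_nullity :: "('v, 'm) lgraph_scheme \<Rightarrow> nat" where
  "graph_nullity G = gf2.dim {f :: 'v \<Rightarrow> bit. (\<forall>u. u \<notin> verts G \<longrightarrow> f u = 0) \<and>
     (\<forall>u\<in>verts G. (\<Sum>v\<in>verts G. adjacency_matrix G u v * f v) = 0)}"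

record ('v, 'a) wgraph = "'v lgraph" +
  alpha :: "'v \<Rightarrow> 'a"
  beta :: "'v \<Rightarrow> 'a"

text \<open>The sort \<open>{comm_ring, comm_monoid_mult}\<close> is that of commutative rings with unity; unlike
  \<open>comm_ring_1\<close> it admits the zero ring.\<close>

definition interlace_poly ::
  "'a \<Rightarrow> 'a \<Rightarrow> ('v, 'a::{comm_ring, comm_monoid_mult}) wgraph \<Rightarrow> 'a" where
  "interlace_poly x y G =
     (\<Sum>S\<in>Pow (verts G). (\<Prod>s\<in>S. alpha G s) * (\<Prod>v\<in>verts G - S. beta G v) *
        (x - 1) ^ graph_rank (induced_subgraph G S) *
        (y - 1) ^ graph_nullity (induced_subgraph G S))"

definition fraternal_twins :: "('v, 'm) lgraph_scheme \<Rightarrow> 'v \<Rightarrow> 'v \<Rightarrow> bool" where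
  "fraternal_twins G a b \<longleftrightarrow>
     a \<in> verts G \<and> b \<in> verts G \<and> a \<noteq> b \<and>
     ((looped G a \<and> looped G b \<and> \<not> adjacent G a b) \<or>
      (\<not> looped G a \<and> \<not> looped G b \<and> adjacent G a b)) \<and>
     (\<forall>v\<in>verts G - {a, b}. adjacent G a v \<longleftrightarrow> adjacent G b v)"

end

theory Submission imports Defs begin

text \<open>The interlace polynomial is split according to which of \<open>a\<close>, \<open>b\<close> a vertex set contains. If it
  contains exactly one of them, exchanging the twins is an isomorphism of induced subgraphs. If it
  contains both, the block of the adjacency matrix on \<open>{a, b}\<close> is the identity or the exchange matrix,
  and over \<open>GF(2)\<close> eliminating this block leaves the rest of the matrix unchanged, because the two
  equal corrections cancel. So removing both twins lowers the rank by \<open>2\<close> and keeps the nullity.\<close>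

section \<open>Dimension over \<open>GF(2)\<close>\<close>

abbreviation scale2 :: "bit \<Rightarrow> ('v \<Rightarrow> bit) \<Rightarrow> 'v \<Rightarrow> bit" where
  "scale2 \<equiv> \<lambda>c f v. c * f v"

interpretation gf2_pair: vector_space_pair "scale2 :: bit \<Rightarrow> ('v \<Rightarrow> bit) \<Rightarrow> 'v \<Rightarrow> bit"
    "scale2 :: bit \<Rightarrow> ('w \<Rightarrow> bit) \<Rightarrow> 'w \<Rightarrow> bit" ..

lemma bit_add_self: "(p::bit) + p = 0"
  by (cases p) simp_all

text \<open>These rules would turn the field operations of \<open>bit\<close> into bitwise ones.\<close>

declare add_bit_eq_xor [simp del] mult_bit_eq_and [simp del]

text \<open>A basis chosen inside \<open>S\<close> stays independent because \<open>f\<close> is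
  injective on its span, and its image still spans the image of \<open>S\<close>. This transports
  ranks and nullities along relabellings and along the extension map for twins.\<close>

lemma gf2_dim_image_eq:
  fixes f :: "('v \<Rightarrow> bit) \<Rightarrow> 'w \<Rightarrow> bit"
  assumes lin: "Vector_Spaces.linear scale2 scale2 f" and inj: "inj_on f (gf2.span S)"
  shows "gf2.dim (f ` S) = gf2.dim S"
proof -
  obtain B where B: "B \<subseteq> S" "gf2.independent B" "S \<subseteq> gf2.span B" "card B = gf2.dim S"
    using gf2.basis_exists by blast
  have injB: "inj_on f (gf2.span B)"
    using inj gf2.span_mono[OF B(1)] by (rule inj_on_subset)
  show ?thesis
  proof (rule gf2.dim_unique)
    show "f ` B \<subseteq> f ` S" using B(1) by blast
    show "f ` S \<subseteq> gf2.span (f ` B)"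
      using B(3) gf2_pair.linear_span_image[OF lin] by blast
    show "gf2.independent (f ` B)"
      using gf2_pair.linear_independent_injective_image[OF lin B(2) injB] .
    show "card (f ` B) = gf2.dim S"
      using B(4) card_image[OF inj_on_subset[OF injB gf2.span_superset]] by simp
  qed
qed

text \<open>A basis of \<open>S\<close> together with \<open>x\<close> is a basis of the larger set.
  Finiteness of \<open>S\<close> makes it finite, so that \<open>card\<close> really grows by
  one.\<close>

lemma gf2_dim_insert:
  assumes fin: "finite S" and x: "x \<notin> gf2.span S"
  shows "gf2.dim (insert x S) = Suc (gf2.dim S)"
proof -
  obtain B where B: "B \<subseteq> S" "gf2.independent B" "S \<subseteq> gf2.span B" "card B = gf2.dim S"
    using gf2.basis_exists by blast
  have xB: "x \<notin> gf2.span B" using x gf2.span_mono[OF B(1)] by blast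
  show ?thesis
  proof (rule gf2.dim_unique)
    show "insert x B \<subseteq> insert x S" using B(1) by blast
    show "insert x S \<subseteq> gf2.span (insert x B)"
      using B(3) gf2.span_mono[of B "insert x B"] gf2.span_base[of x "insert x B"] by blast
    show "gf2.independent (insert x B)" using gf2.independent_insertI[OF xB B(2)] .
    show "card (insert x B) = Suc (gf2.dim S)"
      using finite_subset[OF B(1) fin] xB gf2.span_base[of x B] B(4) by (subst card_insert_disjoint) auto
  qed
qed

section \<open>Rank and nullity of principal submatrices\<close>

text \<open>Padding with zeros keeps the columns of all principal submatrices in one space, that of
  functions on the whole vertex type.\<close>

definition restricted_column :: "('v \<Rightarrow> 'v \<Rightarrow> bit) \<Rightarrow> 'v set \<Rightarrow> 'v \<Rightarrow> 'v \<Rightarrow> bit" where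
  "restricted_column A S v = (\<lambda>u. if u \<in> S then A u v else 0)"

definition principal_rank :: "('v \<Rightarrow> 'v \<Rightarrow> bit) \<Rightarrow> 'v set \<Rightarrow> nat" where
  "principal_rank A S = gf2.dim (restricted_column A S ` S)"

definition principal_kernel :: "('v \<Rightarrow> 'v \<Rightarrow> bit) \<Rightarrow> 'v set \<Rightarrow> ('v \<Rightarrow> bit) set" where
  "principal_kernel A S = {f. (\<forall>u. u \<notin> S \<longrightarrow> f u = 0) \<and> (\<forall>u\<in>S. (\<Sum>v\<in>S. A u v * f v) = 0)}"

text \<open>The kernel is a subspace. In this form, injectivity on the kernel is the injectivity on
  a span that \<open>gf2_dim_image_eq\<close> asks for.\<close>

lemma span_principal_kernel:
  "gf2.span (principal_kernel A S) = principal_kernel A S"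
  by (rule gf2.span_eq_iff[THEN iffD2], rule gf2.subspaceI)
     (auto simp: principal_kernel_def distrib_left sum.distrib mult.left_commute
        simp flip: sum_distrib_left)

lemma linear_comp_right: "Vector_Spaces.linear scale2 scale2 (\<lambda>f :: 'v \<Rightarrow> bit. f \<circ> \<pi>)"
  by (auto simp: Vector_Spaces.linear_iff gf2.vector_space_axioms fun_eq_iff)

lemma inj_on_comp_right:
  assumes "bij \<pi>"
  shows "inj_on (\<lambda>f :: 'v \<Rightarrow> bit. f \<circ> \<pi>) T"
  using assms by (metis bij_is_surj inj_onI surj_fun_eq)

text \<open>Composition with \<open>\<pi>\<close> is linear, is injective since \<open>\<pi>\<close>
  is onto the whole type, and pulls the columns over the image of \<open>S\<close> back to those
  over \<open>S\<close>.\<close>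

lemma principal_rank_bij:
  assumes bij: "bij \<pi>" and A: "\<And>u v. u \<in> S \<Longrightarrow> v \<in> S \<Longrightarrow> A (\<pi> u) (\<pi> v) = A u v"
  shows "principal_rank A (\<pi> ` S) = principal_rank A S"
proof -
  have "(\<lambda>f. f \<circ> \<pi>) ` (restricted_column A (\<pi> ` S) ` \<pi> ` S) = restricted_column A S ` S"
    unfolding image_image
    by (intro image_cong refl)
      (auto simp: restricted_column_def fun_eq_iff A inj_image_mem_iff[OF bij_is_inj[OF bij]])
  then show ?thesis
    unfolding principal_rank_def
    using gf2_dim_image_eq[OF linear_comp_right inj_on_comp_right[OF bij]] by metis
qed

lemma principal_kernel_bij:
  assumes bij: "bij \<pi>" and A: "\<And>u v. u \<in> S \<Longrightarrow> v \<in> S \<Longrightarrow> A (\<pi> u) (\<pi> v) = A u v"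
  shows "gf2.dim (principal_kernel A (\<pi> ` S)) = gf2.dim (principal_kernel A S)"
proof -
  note inj = bij_is_inj[OF bij]
  have mem: "f \<circ> \<pi> \<in> principal_kernel A S \<longleftrightarrow> f \<in> principal_kernel A (\<pi> ` S)" for f
  proof -
    have "(\<forall>u. u \<notin> S \<longrightarrow> f (\<pi> u) = 0) \<longleftrightarrow> (\<forall>w. w \<notin> \<pi> ` S \<longrightarrow> f w = 0)"
      using bij_is_surj[OF bij] inj_image_mem_iff[OF inj] by (metis surjD)
    moreover have "(\<Sum>v\<in>\<pi> ` S. A (\<pi> u) v * f v) = (\<Sum>v\<in>S. A u v * f (\<pi> v))" if "u \<in> S" for u
      by (subst sum.reindex[OF inj_on_subset[OF inj]]) (auto simp: A that)
    ultimately show ?thesis by (auto simp: principal_kernel_def)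
  qed
  have "(\<lambda>f. f \<circ> \<pi>) ` principal_kernel A (\<pi> ` S) = principal_kernel A S" (is "?F ` _ = _")
  proof (intro subset_antisym subsetI)
    fix g assume g: "g \<in> principal_kernel A S"
    have eq: "g = ?F (g \<circ> inv \<pi>)" by (simp add: fun_eq_iff inj)
    then have "g \<circ> inv \<pi> \<in> principal_kernel A (\<pi> ` S)" using g mem by metis
    with eq show "g \<in> ?F ` principal_kernel A (\<pi> ` S)" by (rule image_eqI)
  qed (auto simp: mem)
  then show ?thesis
    using gf2_dim_image_eq[OF linear_comp_right inj_on_comp_right[OF bij]] by metis
qed

text \<open>The transposition of \<open>a\<close> and \<open>b\<close> fixes \<open>T\<close>
  pointwise and carries \<open>insert a T\<close> to \<open>insert b T\<close> without changing the
  entries of \<open>A\<close>, so relabelling applies.\<close>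

lemma
  assumes swap: "A a a = A b b" "A a b = A b a"
    and rows: "\<And>t. t \<in> T \<Longrightarrow> A a t = A b t" and cols: "\<And>t. t \<in> T \<Longrightarrow> A t a = A t b"
    and "a \<notin> T" "b \<notin> T"
  shows principal_rank_swap: "principal_rank A (insert b T) = principal_rank A (insert a T)"
    and principal_nullity_swap:
      "gf2.dim (principal_kernel A (insert b T)) = gf2.dim (principal_kernel A (insert a T))"
proof -
  define \<pi> where "\<pi> = id(a := b, b := a)"
  have "\<pi> \<circ> \<pi> = id" by (auto simp: \<pi>_def fun_eq_iff)
  then have bij: "bij \<pi>" using o_bij by blast
  have fix_T: "\<pi> t = t" if "t \<in> T" for t using that assms(5,6) by (auto simp: \<pi>_def)
  then have im: "\<pi> ` insert a T = insert b T" by (force simp: \<pi>_def)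
  have A: "A (\<pi> u) (\<pi> v) = A u v" if "u \<in> insert a T" "v \<in> insert a T" for u v
  proof -
    have "\<pi> a = b" by (simp add: \<pi>_def)
    with that show ?thesis by (auto simp: fix_T swap rows cols)
  qed
  show "principal_rank A (insert b T) = principal_rank A (insert a T)"
    "gf2.dim (principal_kernel A (insert b T)) = gf2.dim (principal_kernel A (insert a T))"
    using principal_rank_bij[of \<pi> "insert a T" A, OF bij A]
      principal_kernel_bij[of \<pi> "insert a T" A, OF bij A] unfolding im by auto
qed

text \<open>Column operations: the columns of \<open>a\<close> and \<open>b\<close> add up to the
  indicator \<open>d\<close> of the twins, and multiples of \<open>d\<close> clear rows
  \<open>a\<close> and \<open>b\<close> in the other columns. What remains is the padded columns
  over \<open>T\<close> and two further independent vectors.\<close>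

lemma principal_rank_insert_twins:
  fixes A :: "'v \<Rightarrow> 'v \<Rightarrow> bit"
  assumes fin: "finite T" and nin: "a \<notin> T" "b \<notin> T" and ab: "a \<noteq> b"
    and diag: "A b b = A a a" and off: "A a b = A a a + 1" "A b a = A a a + 1"
    and rows: "\<And>t. t \<in> T \<Longrightarrow> A b t = A a t" and cols: "\<And>t. t \<in> T \<Longrightarrow> A t b = A t a"
  shows "principal_rank A (insert a (insert b T)) = principal_rank A T + 2"
proof -
  define S where "S = insert a (insert b T)"
  define C where "C = restricted_column A S"
  define C0 where "C0 = restricted_column A T"
  define d :: "'v \<Rightarrow> bit" where "d = (\<lambda>u. if u = a \<or> u = b then 1 else 0)"
  have Cb: "C b = C a + d"
    using nin ab cols by (auto simp: fun_eq_iff C_def restricted_column_def S_def d_def diag off bit_add_self add.assoc)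
  have Ct: "C t = C0 t + scale2 (A a t) d" if "t \<in> T" for t
    using that nin ab rows by (auto simp: fun_eq_iff C_def C0_def restricted_column_def S_def d_def)
  have selfadd: "p + q + q = p" for p q :: "'v \<Rightarrow> bit"
    by (simp add: fun_eq_iff add.assoc bit_add_self)
  have d: "d = C a + C b" unfolding Cb
    using selfadd[of d "C a"] by (simp add: ac_simps)
  have C0t: "C0 t = C t + scale2 (A a t) d" if "t \<in> T" for t
    unfolding Ct[OF that] selfadd ..
  let ?X = "insert (C a) (insert (C b) (C ` T))" and ?Y = "insert (C a) (insert d (C0 ` T))"
  have "?X \<subseteq> gf2.span ?Y"
    by (auto simp: Cb Ct gf2.span_base intro!: gf2.span_add gf2.span_scale)
  moreover have dX: "d \<in> gf2.span ?X"
    unfolding d by (intro gf2.span_add gf2.span_base) auto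
  have "?Y \<subseteq> gf2.span ?X"
    by (auto simp: C0t gf2.span_base dX intro!: gf2.span_add gf2.span_scale)
  ultimately have span: "gf2.span ?X = gf2.span ?Y"
    by (simp add: gf2.span_eq)
  \<comment> \<open>Two linear conditions separate the new vectors: the padded columns vanish at
    \<open>a\<close> but \<open>d\<close> does not; then all of these agree at \<open>a\<close> and
    \<open>b\<close>, but \<open>C a\<close> does not.\<close>
  have "gf2.span (C0 ` T) \<subseteq> {f. f a = 0}"
    by (rule gf2.span_minimal) (use nin in \<open>auto simp: C0_def restricted_column_def gf2.subspace_def\<close>)
  then have d_notin: "d \<notin> gf2.span (C0 ` T)" by (auto simp: d_def)
  have "gf2.span (insert d (C0 ` T)) \<subseteq> {f. f a = f b}"
    by (rule gf2.span_minimal)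
      (use nin in \<open>auto simp: C0_def restricted_column_def d_def gf2.subspace_def\<close>)
  moreover have "C a a \<noteq> C a b"
    by (auto simp: C_def restricted_column_def S_def off)
  ultimately have "C a \<notin> gf2.span (insert d (C0 ` T))" by auto
  then have "gf2.dim ?Y = gf2.dim (C0 ` T) + 2"
    using fin d_notin by (simp add: gf2_dim_insert)
  then have "gf2.dim ?X = gf2.dim (C0 ` T) + 2"
    using span gf2.dim_span[of ?X] gf2.dim_span[of ?Y] by metis
  then show ?thesis
    by (simp add: principal_rank_def C_def C0_def S_def)
qed

text \<open>Adding the equations of the rows \<open>a\<close> and \<open>b\<close> gives \<open>f a = f b\<close>, after which row \<open>a\<close> determines
  this common value and the columns \<open>a\<close> and \<open>b\<close> cancel in the remaining rows.\<close>

lemma principal_nullity_insert_twins: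
  fixes A :: "'v \<Rightarrow> 'v \<Rightarrow> bit"
  assumes fin: "finite T" and nin: "a \<notin> T" "b \<notin> T" and ab: "a \<noteq> b"
    and diag: "A b b = A a a" and off: "A a b = A a a + 1" "A b a = A a a + 1"
    and rows: "\<And>t. t \<in> T \<Longrightarrow> A b t = A a t" and cols: "\<And>t. t \<in> T \<Longrightarrow> A t b = A t a"
  shows "gf2.dim (principal_kernel A (insert a (insert b T))) = gf2.dim (principal_kernel A T)"
proof -
  define S where "S = insert a (insert b T)"
  define r where "r f = (\<Sum>t\<in>T. A a t * f t)" for f
  \<comment> \<open>\<open>F\<close> extends a kernel vector over \<open>T\<close> by the only twin
    values that rows \<open>a\<close> and \<open>b\<close> allow; it will be the isomorphism of the
    two kernels.\<close>
  define F :: "('v \<Rightarrow> bit) \<Rightarrow> 'v \<Rightarrow> bit" where "F f = f(a := r f, b := r f)" for f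
  have sumS: "(\<Sum>v\<in>S. A u v * f v) = A u a * f a + A u b * f b + (\<Sum>t\<in>T. A u t * f t)" for u f
    using fin nin ab by (simp add: S_def add.assoc)
  have rb: "(\<Sum>t\<in>T. A b t * f t) = r f" for f
    unfolding r_def by (intro sum.cong) (auto simp: rows)
  have kerS: "f \<in> principal_kernel A S \<longleftrightarrow> (\<forall>u. u \<notin> S \<longrightarrow> f u = 0) \<and>
      f a = r f \<and> f b = r f \<and> (\<forall>u\<in>T. (\<Sum>t\<in>T. A u t * f t) = 0)" for f
  proof -
    have two: "A a a * f a + A a b * f b + r f = 0 \<and> A b a * f a + A b b * f b + r f = 0
        \<longleftrightarrow> f a = r f \<and> f b = r f"
      unfolding diag off by (cases "A a a"; cases "f a"; cases "f b"; cases "r f") simp_all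
    have row: "(\<Sum>v\<in>S. A u v * f v) = (\<Sum>t\<in>T. A u t * f t)" if "f a = f b" "u \<in> T" for u
      using that by (simp add: sumS cols bit_add_self)
    have "(\<forall>u\<in>S. (\<Sum>v\<in>S. A u v * f v) = 0) \<longleftrightarrow> (\<Sum>v\<in>S. A a v * f v) = 0 \<and>
        (\<Sum>v\<in>S. A b v * f v) = 0 \<and> (\<forall>u\<in>T. (\<Sum>v\<in>S. A u v * f v) = 0)"
      by (auto simp: S_def)
    also have "\<dots> \<longleftrightarrow> f a = r f \<and> f b = r f \<and> (\<forall>u\<in>T. (\<Sum>v\<in>S. A u v * f v) = 0)"
      using two unfolding sumS[of a] sumS[of b] rb r_def[symmetric] by blast
    also have "\<dots> \<longleftrightarrow> f a = r f \<and> f b = r f \<and> (\<forall>u\<in>T. (\<Sum>t\<in>T. A u t * f t) = 0)"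
      using row by auto
    finally show ?thesis
      unfolding principal_kernel_def by blast
  qed
  have lin: "Vector_Spaces.linear scale2 scale2 F"
    by (auto simp: Vector_Spaces.linear_iff gf2.vector_space_axioms F_def r_def fun_eq_iff distrib_left
        sum.distrib mult.left_commute sum_distrib_left)
  \<comment> \<open>\<open>F\<close> overwrites the values at \<open>a\<close> and \<open>b\<close>,
    but kernel vectors over \<open>T\<close> are zero there, so nothing is lost.\<close>
  have inj: "inj_on F (principal_kernel A T)"
  proof (rule inj_onI)
    fix f g assume f: "f \<in> principal_kernel A T" and g: "g \<in> principal_kernel A T" and eq: "F f = F g"
    show "f = g"
    proof
      fix v show "f v = g v"
        using f g fun_cong[OF eq, of v] nin
        by (cases "v = a \<or> v = b") (auto simp: principal_kernel_def F_def)
    qed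
  qed
  have sumF: "(\<Sum>t\<in>T. A u t * F f t) = (\<Sum>t\<in>T. A u t * f t)" for u f
    using nin by (intro sum.cong) (auto simp: F_def)
  have rF: "r (F f) = r f" for f unfolding r_def by (rule sumF)
  have "F ` principal_kernel A T = principal_kernel A S"
  proof (intro subset_antisym subsetI)
    fix g assume "g \<in> F ` principal_kernel A T"
    then show "g \<in> principal_kernel A S"
      unfolding kerS by (auto simp: rF sumF) (auto simp: principal_kernel_def F_def S_def)
  next
    fix g assume g: "g \<in> principal_kernel A S"
    \<comment> \<open>The preimage forgets the twin values; sums over \<open>T\<close> do not see
      the change.\<close>
    define f where "f = g(a := 0, b := 0)"
    have sumf: "(\<Sum>t\<in>T. A u t * f t) = (\<Sum>t\<in>T. A u t * g t)" for u
      using nin by (intro sum.cong) (auto simp: f_def)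
    have "r f = r g" unfolding r_def by (rule sumf)
    then have "g = F f"
      using g unfolding kerS by (auto simp: F_def f_def fun_eq_iff)
    moreover have "f \<in> principal_kernel A T"
      using g unfolding kerS by (auto simp: principal_kernel_def sumf) (auto simp: f_def S_def)
    ultimately show "g \<in> F ` principal_kernel A T" by blast
  qed
  then show ?thesis
    using gf2_dim_image_eq[OF lin, of "principal_kernel A T"] inj
    by (simp add: span_principal_kernel S_def)
qed

section \<open>Induced subgraphs and twin reduction\<close>

lemma adjacency_matrix_induced_subgraph:
  "u \<in> S \<Longrightarrow> v \<in> S \<Longrightarrow> adjacency_matrix (induced_subgraph G S) u v = adjacency_matrix G u v"
  by (simp add: adjacency_matrix_def induced_subgraph_def looped_def adjacent_def)

lemma adjacency_matrix_induced_subgraph_outside: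
  "u \<notin> S \<Longrightarrow> adjacency_matrix (induced_subgraph G S) u v = 0"
  by (auto simp add: adjacency_matrix_def induced_subgraph_def looped_def adjacent_def)

lemma verts_induced_subgraph [simp]: "verts (induced_subgraph G S) = S"
  by (simp add: induced_subgraph_def)

text \<open>The columns in \<open>graph_rank\<close> are not cut off, but edges of the induced
  subgraph lie in \<open>S\<close>, so they already vanish outside. All ranks thus refer to the one
  matrix of \<open>G\<close>.\<close>

lemma graph_rank_induced_subgraph:
  "graph_rank (induced_subgraph G S) = principal_rank (adjacency_matrix G) S"
proof -
  have "(\<lambda>u. adjacency_matrix (induced_subgraph G S) u v) = restricted_column (adjacency_matrix G) S v"
    if "v \<in> S" for v
    using that by (auto simp: restricted_column_def fun_eq_iff adjacency_matrix_induced_subgraph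
        adjacency_matrix_induced_subgraph_outside)
  then show ?thesis
    by (simp add: graph_rank_def principal_rank_def)
qed

lemma graph_nullity_induced_subgraph:
  "graph_nullity (induced_subgraph G S) = gf2.dim (principal_kernel (adjacency_matrix G) S)"
  by (simp add: graph_nullity_def principal_kernel_def adjacency_matrix_induced_subgraph)

lemma sum_Pow_insert:
  assumes "finite A" "a \<notin> A"
  shows "(\<Sum>S\<in>Pow (insert a A). f S) = (\<Sum>S\<in>Pow A. f S + f (insert a S))"
proof -
  have inj: "inj_on (insert a) (Pow A)"
    using assms(2) by (auto simp: inj_on_def)
  have "(\<Sum>S\<in>Pow (insert a A). f S) = sum f (Pow A) + sum f (insert a ` Pow A)"
    unfolding Pow_insert using assms by (intro sum.union_disjoint) auto
  also have "sum f (insert a ` Pow A) = (\<Sum>S\<in>Pow A. f (insert a S))"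
    by (simp add: sum.reindex[OF inj])
  finally show ?thesis by (simp add: sum.distrib)
qed

theorem theorem6:
  fixes G G' :: "('v, 'a::{comm_ring, comm_monoid_mult}) wgraph"
    and a b :: 'v
    and x y :: 'a
  assumes "lgraph G"
    and "fraternal_twins G a b"
    and "G' = (delete_vertex G b)
           \<lparr>alpha := (alpha G)(a := alpha G a * beta G b + beta G a * alpha G b),
            beta := (beta G)(a := beta G a * beta G b + alpha G a * alpha G b * (x - 1)\<^sup>2)\<rparr>"
  shows "interlace_poly x y G = interlace_poly x y G'"
proof -
  let ?A = "adjacency_matrix G"
  define W where "W = verts G - {a, b}"
  have ab: "a \<noteq> b" and V: "verts G = insert b (insert a W)"
    using assms(2) by (auto simp: W_def fraternal_twins_def)
  have finW: "finite W" and nin: "a \<notin> W" "b \<notin> W"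
    using assms(1) by (auto simp: lgraph_def W_def)
  have V': "verts G' = insert a W"
    using ab nin V by (auto simp: assms(3) delete_vertex_def)
  \<comment> \<open>Such an \<open>S\<close> avoids \<open>b\<close>, and the new weights do not
    affect adjacency, so the matrix of \<open>G\<close> serves for \<open>G'\<close> as
    well.\<close>
  have G'_sub: "graph_rank (induced_subgraph G' S) = principal_rank ?A S"
    "graph_nullity (induced_subgraph G' S) = gf2.dim (principal_kernel ?A S)"
    if "S \<subseteq> insert a W" for S
  proof -
    have eq: "?A u v = adjacency_matrix G' u v" if "u \<in> S" "v \<in> S" for u v
      using that \<open>S \<subseteq> insert a W\<close> nin ab V
      by (auto simp: assms(3) delete_vertex_def induced_subgraph_def adjacency_matrix_def
          adjacent_def looped_def)
    have "restricted_column (adjacency_matrix G') S v = restricted_column ?A S v" if "v \<in> S" for v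
      using that by (auto simp: restricted_column_def eq)
    then show "graph_rank (induced_subgraph G' S) = principal_rank ?A S"
      by (simp add: graph_rank_induced_subgraph principal_rank_def)
    show "graph_nullity (induced_subgraph G' S) = gf2.dim (principal_kernel ?A S)"
      by (simp add: graph_nullity_induced_subgraph principal_kernel_def eq)
  qed
  have sym: "?A u v = ?A v u" for u v
    by (simp add: adjacency_matrix_def adjacent_def insert_commute)
  \<comment> \<open>Both cases of the twin condition at once: the loops agree, and adjacency is the
    complement of being looped.\<close>
  have diag: "?A b b = ?A a a" and off: "?A a b = ?A a a + 1" "?A b a = ?A a a + 1"
    using assms(2) sym[of a b]
    by (auto simp: fraternal_twins_def adjacency_matrix_def bit_add_self)
  have rows: "?A b t = ?A a t" if "t \<in> W" for t
    using that assms(2) by (auto simp: fraternal_twins_def adjacency_matrix_def W_def)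
  then have cols: "?A t b = ?A t a" if "t \<in> W" for t
    using that sym by metis
  define m where
    "m S = (x - 1) ^ principal_rank ?A S * (y - 1) ^ gf2.dim (principal_kernel ?A S)" for S
  have m_b: "m (insert b T) = m (insert a T)" if "T \<subseteq> W" for T
  proof -
    have "a \<notin> T" "b \<notin> T" using that nin by auto
    then show ?thesis
      unfolding m_def
      using principal_rank_swap[of ?A a b T] principal_nullity_swap[of ?A a b T]
        that diag sym rows cols by (auto simp: subset_iff)
  qed
  \<comment> \<open>The square is the rank increase of two; the nullity is unchanged.\<close>
  have m_ab: "m (insert b (insert a T)) = (x - 1)\<^sup>2 * m T" if "T \<subseteq> W" for T
  proof -
    have T: "finite T" "a \<notin> T" "b \<notin> T" using that nin finite_subset[OF that finW] by auto
    have rT: "?A b t = ?A a t" and cT: "?A t b = ?A t a" if "t \<in> T" for t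
      using that \<open>T \<subseteq> W\<close> rows cols by auto
    show ?thesis
      unfolding m_def insert_commute[of b a] principal_rank_insert_twins[of T a b ?A, OF T ab diag off rT cT, simplified]
        principal_nullity_insert_twins[of T a b ?A, OF T ab diag off rT cT, simplified]
      by (simp add: power_add power2_eq_square ac_simps)
  qed
  \<comment> \<open>The weight factor without the twins, common to all terms that arise from the
    same \<open>T\<close>.\<close>
  define w where "w T = (\<Prod>s\<in>T. alpha G s) * (\<Prod>v\<in>W - T. beta G v)" for T
  have same: "alpha G' v = alpha G v" "beta G' v = beta G v" if "v \<noteq> a" for v
    using that by (simp_all add: assms(3) delete_vertex_def induced_subgraph_def)
  have w': "(\<Prod>s\<in>T. alpha G' s) * (\<Prod>v\<in>W - T. beta G' v) = w T" if "T \<subseteq> W" for T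
    unfolding w_def using that nin by (intro arg_cong2[of _ _ _ _ "(*)"] prod.cong) (auto intro!: same)
  define c where "c S = (\<Prod>s\<in>S. alpha G s) * (\<Prod>v\<in>verts G - S. beta G v) * m S" for S
  define c' where "c' S = (\<Prod>s\<in>S. alpha G' s) * (\<Prod>v\<in>verts G' - S. beta G' v) * m S" for S
  have "interlace_poly x y G = (\<Sum>S\<in>Pow (insert b (insert a W)). c S)"
    unfolding interlace_poly_def V[symmetric]
    by (simp add: c_def m_def graph_rank_induced_subgraph graph_nullity_induced_subgraph mult.assoc)
  also have "\<dots> = (\<Sum>T\<in>Pow W. c T + c (insert b T) + (c (insert a T) + c (insert b (insert a T))))"
    using finW nin ab by (simp add: sum_Pow_insert)
  \<comment> \<open>Neither or both twins give multiples of \<open>m T\<close>, which combine into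
    the new \<open>beta\<close> at \<open>a\<close>; exactly one twin gives multiples of
    \<open>m (insert a T)\<close>, which combine into the new \<open>alpha\<close>.\<close>
  also have "\<dots> = (\<Sum>T\<in>Pow W. c' T + c' (insert a T))"
  proof (rule sum.cong[OF refl])
    fix T assume "T \<in> Pow W"
    then have TW: "T \<subseteq> W" by simp
    have T: "a \<notin> T" "b \<notin> T" "finite T" using TW nin finite_subset[OF TW finW] by auto
    have diffs: "verts G - T = insert a (insert b (W - T))"
      "verts G - insert a T = insert b (W - T)" "verts G - insert b T = insert a (W - T)"
      "verts G - insert b (insert a T) = W - T"
      "verts G' - T = insert a (W - T)" "verts G' - insert a T = W - T"
      unfolding V V' using T nin ab by auto
    have c: "c T = beta G a * beta G b * (w T * m T)"
      "c (insert a T) = alpha G a * beta G b * (w T * m (insert a T))"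
      "c (insert b T) = beta G a * alpha G b * (w T * m (insert a T))"
      "c (insert b (insert a T)) = alpha G a * alpha G b * (x - 1)\<^sup>2 * (w T * m T)"
      using T nin ab finW m_b[OF TW] m_ab[OF TW]
      by (simp_all add: c_def diffs w_def ac_simps)
    have "c' T = beta G' a * (w T * m T)" "c' (insert a T) = alpha G' a * (w T * m (insert a T))"
      using T nin finW w'[OF TW, symmetric]
      by (simp_all add: c'_def diffs ac_simps)
    moreover have "alpha G' a = alpha G a * beta G b + beta G a * alpha G b"
      "beta G' a = beta G a * beta G b + alpha G a * alpha G b * (x - 1)\<^sup>2"
      by (simp_all add: assms(3))
    ultimately show "c T + c (insert b T) + (c (insert a T) + c (insert b (insert a T)))
        = c' T + c' (insert a T)"
      unfolding c by (simp add: distrib_left distrib_right ac_simps)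
  qed
  also have "\<dots> = (\<Sum>S\<in>Pow (insert a W). c' S)"
    using finW nin by (simp add: sum_Pow_insert)
  also have "\<dots> = interlace_poly x y G'"
    unfolding interlace_poly_def V'
    by (intro sum.cong refl) (simp add: c'_def m_def G'_sub V' mult.assoc)
  finally show ?thesis .
qed

end
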